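(* Let $G:\mathbb{H}\to\mathbb{R}$ be $\mu$-strongly convex and locally Lipschitz smooth in the strong sense (both with respect to the preconditioner $\mathcal{L}$). Let $\eta>0$, $x_0\in\mathbb{H}$, and let $X:[0,\infty)\to\mathbb{H}$ be the unique solution of the initial value problem $$\ddot X(t)+2\eta\dot X(t)+\mathcal{L}^{-1}G'(X(t))=0,\quad t>0,\qquad X(0)=x_0,\quad \dot X(0)=0.$$ Put $V(t)=X(t)-x^*+\frac1\eta\dot X(t)$ and $E(X,V)=\frac\eta2\|V\|_{\mathcal{L}}^2+\frac1\eta(G(X)-G^* )$. If $\eta^2\le\mu$, then the function $\mathcal{E}(t)=e^{\eta t}E(X(t),V(t))$ is nonincreasing. Consequently, for all $t\geq 0$, $$E(X(t),V(t))=\frac\eta2\|V(t)\|_{\mathcal{L}}^2+\frac1\eta\big(G(X(t))-G^*\big)\le e^{-\eta t}E_0,$$ where $E_0=\frac1\eta(G(x_0)-G^* )+\frac\eta2\|x_0-x^*\|_{\mathcal{L}}^2$.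
   Context: $\mathbb{H}$ is a real separable Hilbert space with norm $\|\cdot\|_{\mathbb{H}}$, $\mathbb{H}'$ is its dual, and $\langle f,v\rangle=f(v)$ is the duality pairing. The preconditioner $\mathcal{L}:\mathbb{H}\to\mathbb{H}'$ is a linear operator such that, with $(x,y)_{\mathcal{L}}:=\langle\mathcal{L}x,y\rangle$, there are $C_1,C_2>0$ with $(x,y)_{\mathcal{L}}=(y,x)_{\mathcal{L}}$, $(x,y)_{\mathcal{L}}\le C_2\|x\|_{\mathbb{H}}\|y\|_{\mathbb{H}}$, and $C_1\|x\|_{\mathbb{H}}^2\le (x,x)_{\mathcal{L}}$ for all $x,y\in\mathbb{H}$. Then $\|x\|_{\mathcal{L}}:=\sqrt{(x,x)_{\mathcal{L}}}$ is a norm equivalent to $\|\cdot\|_{\mathbb{H}}$, $\mathcal{L}$ is invertible, and $\|f\|_{\mathcal{L}^{-1}}:=\sqrt{\langle f,\mathcal{L}^{-1}f\rangle}$ is a norm on $\mathbb{H}'$. $G:\mathbb{H}\to\mathbb{R}$ is Fréchet differentiable at every point, with derivative $G'(x)\in\mathbb{H}'$. $G$ is $\mu$-strongly convex if $\mu>0$ and $\langle G'(x)-G'(y),x-y\rangle\ge\mu\|x-y\|_{\mathcal{L}}^2$ for all $x,y\in\mathbb{H}$. $G$ is locally Lipschitz smooth in the strong sense if for every bounded convex set $B\subset\mathbb{H}$ there is $L_B>0$ with $\|G'(x)-G'(y)\|_{\mathcal{L}^{-1}}\le L_B\|x-y\|_{\mathcal{L}}$ for all $x,y\in B$. $x^*$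 denotes the unique minimizer of $G$ over $\mathbb{H}$ and $G^*=G(x^* )$. Under these hypotheses the initial value problem is known to have a unique global solution $X$, which is twice continuously differentiable on $(0,\infty)$ with $X$ and $\dot X$ continuous on $[0,\infty)$. *)

theory Defs
  imports "HOL-Analysis.Analysis"
begin

text \<open>
  The dual of a real Hilbert space \<open>'a\<close> is the type \<open>'a \<Rightarrow>\<^sub>L real\<close> of bounded linear functionals,
  and the duality pairing of \<open>f\<close> and \<open>v\<close> is the application \<open>blinfun_apply f v\<close>.
\<close>

definition inner_L :: "('a::real_inner \<Rightarrow> ('a \<Rightarrow>\<^sub>L real)) \<Rightarrow> 'a \<Rightarrow> 'a \<Rightarrow> real" where
  "inner_L L x y = blinfun_apply (L x) y"

definition norm_L :: "('a::real_inner \<Rightarrow> ('a \<Rightarrow>\<^sub>L real)) \<Rightarrow> 'a \<Rightarrow> real" where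
  "norm_L L x = sqrt (inner_L L x x)"

definition preconditioner :: "('a::real_inner \<Rightarrow> ('a \<Rightarrow>\<^sub>L real)) \<Rightarrow> bool" where
  "preconditioner L \<longleftrightarrow> linear L \<and>
     (\<exists>C1>0. \<exists>C2>0. \<forall>x y.
        inner_L L x y = inner_L L y x \<and>
        inner_L L x y \<le> C2 * norm x * norm y \<and>
        C1 * (norm x)\<^sup>2 \<le> inner_L L x x)"

text \<open>
  A preconditioner on a Hilbert space is bijective (Lax--Milgram), so that \<open>inv L\<close> is its
  two-sided inverse.
\<close>

definition dual_norm_L :: "('a::real_inner \<Rightarrow> ('a \<Rightarrow>\<^sub>L real)) \<Rightarrow> ('a \<Rightarrow>\<^sub>L real) \<Rightarrow> real" where
  "dual_norm_L L f = sqrt (blinfun_apply f (inv L f))"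

definition frechet_deriv_of ::
    "('a::real_inner \<Rightarrow> real) \<Rightarrow> ('a \<Rightarrow> ('a \<Rightarrow>\<^sub>L real)) \<Rightarrow> bool" where
  "frechet_deriv_of G G' \<longleftrightarrow> (\<forall>x. (G has_derivative blinfun_apply (G' x)) (at x))"

text \<open>Strong convexity and smoothness of \<open>G\<close> are conditions on its derivative \<open>G'\<close>.\<close>

definition strongly_convex ::
    "('a::real_inner \<Rightarrow> ('a \<Rightarrow>\<^sub>L real)) \<Rightarrow> real \<Rightarrow> ('a \<Rightarrow> ('a \<Rightarrow>\<^sub>L real)) \<Rightarrow> bool" where
  "strongly_convex L \<mu> G' \<longleftrightarrow> \<mu> > 0 \<and>
     (\<forall>x y. blinfun_apply (G' x - G' y) (x - y) \<ge> \<mu> * (norm_L L (x - y))\<^sup>2)"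

definition locally_lipschitz_smooth ::
    "('a::real_inner \<Rightarrow> ('a \<Rightarrow>\<^sub>L real)) \<Rightarrow> ('a \<Rightarrow> ('a \<Rightarrow>\<^sub>L real)) \<Rightarrow> bool" where
  "locally_lipschitz_smooth L G' \<longleftrightarrow>
     (\<forall>B. bounded B \<and> convex B \<longrightarrow>
        (\<exists>LB>0. \<forall>x\<in>B. \<forall>y\<in>B. dual_norm_L L (G' x - G' y) \<le> LB * norm_L L (x - y)))"

text \<open>
  \<open>X\<close> is a global solution with velocity \<open>X'\<close>, in the regularity class twice continuously
  differentiable on \<open>(0,\<infinity>)\<close>, with \<open>X\<close> and \<open>X'\<close> continuous on \<open>[0,\<infinity>)\<close>.  At \<open>t = 0\<close> the
  derivative of \<open>X\<close> is one-sided; for \<open>t > 0\<close>, \<open>at t within {0..}\<close> is \<open>at t\<close>.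
\<close>

definition ivp_solution ::
    "('a::real_inner \<Rightarrow> ('a \<Rightarrow>\<^sub>L real)) \<Rightarrow> ('a \<Rightarrow> ('a \<Rightarrow>\<^sub>L real)) \<Rightarrow> real \<Rightarrow> 'a \<Rightarrow>
     (real \<Rightarrow> 'a) \<Rightarrow> (real \<Rightarrow> 'a) \<Rightarrow> bool" where
  "ivp_solution L G' \<eta> x0 X X' \<longleftrightarrow>
     continuous_on {0..} X \<and> continuous_on {0..} X' \<and>
     (\<forall>t\<ge>0. (X has_vector_derivative X' t) (at t within {0..})) \<and>
     (\<exists>X''. continuous_on {0<..} X'' \<and>
        (\<forall>t>0. (X' has_vector_derivative X'' t) (at t) \<and>
           X'' t + (2 * \<eta>) *\<^sub>R X' t + inv L (G' (X t)) = 0)) \<and>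
     X 0 = x0 \<and> X' 0 = 0"

definition energy ::
    "('a::real_inner \<Rightarrow> ('a \<Rightarrow>\<^sub>L real)) \<Rightarrow> ('a \<Rightarrow> real) \<Rightarrow> 'a \<Rightarrow> real \<Rightarrow> 'a \<Rightarrow> 'a \<Rightarrow> real" where
  "energy L G xstar \<eta> x v = \<eta> / 2 * (norm_L L v)\<^sup>2 + 1 / \<eta> * (G x - G xstar)"

end

theory Submission
  imports Defs
begin

text \<open>
  Write \<open>(x, y)\<close> for the bilinear form of the preconditioner, \<open>\<parallel>x\<parallel>\<^sup>2 = (x, x)\<close>, and
  \<open>W = X - x*\<close>.  Since \<open>V = W + X'/\<eta>\<close>, the equation of motion gives
  \<open>V' = - X' - L\<inverse> G'(X)/\<eta>\<close>, where \<open>X' = \<eta> (V - W)\<close>.  In the derivative of the energy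
  \<open>E = \<eta>/2 \<parallel>V\<parallel>\<^sup>2 + (G(X) - G(x*))/\<eta>\<close> the two terms \<open>\<plusminus>G'(X) X'/\<eta>\<close> cancel, which leaves
  \<open>E' = - \<eta>\<^sup>2 (V, V - W) - G'(X) W\<close>.  Strong convexity gives the lower quadratic bound
  \<open>G(x*) \<ge> G(X) - G'(X) W + \<mu>/2 \<parallel>W\<parallel>\<^sup>2\<close> (lemma \<open>strongly_convex_lower_bound\<close>), and therefore
  \<open>E' + \<eta> E \<le> - \<eta>\<^sup>2/2 \<parallel>V - W\<parallel>\<^sup>2 + (\<eta>\<^sup>2 - \<mu>)/2 \<parallel>W\<parallel>\<^sup>2 \<le> 0\<close>
  (lemma \<open>energy_rate_nonpos\<close>).  Thus \<open>exp(\<eta> t) E\<close> has nonpositive derivative on the open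
  half-line and is continuous up to \<open>0\<close>, so it is nonincreasing; the decay estimate is the
  comparison with its value at \<open>0\<close>, where the velocity vanishes.

  The pairing \<open>(V, L\<inverse> G'(X)) = G'(X) V\<close> needs \<open>L\<close> to be surjective.  This is the symmetric
  Lax--Milgram theorem (lemma \<open>preconditioner_surj\<close>): the functional
  \<open>J(x) = \<parallel>x\<parallel>\<^sup>2 - 2 f(x)\<close> attains its infimum, because by the parallelogram law its sublevel
  sets shrink to a point, and \<open>L z = f\<close> holds at the minimizer \<open>z\<close>.
\<close>

section \<open>The bilinear form of a preconditioner\<close>

lemma preconditioner_bounded_linear:
  assumes "preconditioner L"
  shows "bounded_linear L"
proof -
  from assms obtain C2 where lin: "linear L" and "C2 > 0"
    and ub: "\<And>x y. inner_L L x y \<le> C2 * norm x * norm y"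
    unfolding preconditioner_def by blast
  have "norm (L x) \<le> norm x * C2" for x
  proof (rule norm_blinfun_bound)
    fix y
    have "L x y \<le> C2 * norm x * norm y" "- L x y \<le> C2 * norm x * norm y"
      using ub[of x y] ub[of x "- y"] by (simp_all add: inner_L_def blinfun.minus_right)
    then show "norm (L x y) \<le> norm x * C2 * norm y"
      by (simp add: mult.commute mult.left_commute)
  qed (use \<open>C2 > 0\<close> in simp)
  with lin show ?thesis
    by (auto simp: bounded_linear_def bounded_linear_axioms_def)
qed

lemma preconditioner_sym:
  assumes "preconditioner L"
  shows "L x y = L y x"
  using assms unfolding preconditioner_def inner_L_def by blast

lemma preconditioner_coercive:
  assumes "preconditioner L"
  obtains C where "C > 0" "\<And>x. C * (norm x)\<^sup>2 \<le> L x x"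
  using assms unfolding preconditioner_def inner_L_def by blast

lemma preconditioner_nonneg:
  assumes "preconditioner L"
  shows "L x x \<ge> 0"
proof -
  obtain C where "C > 0" "C * (norm x)\<^sup>2 \<le> L x x"
    using preconditioner_coercive[OF assms] by metis
  then show ?thesis
    by (smt (verit) mult_nonneg_nonneg zero_le_power2)
qed

lemma norm_L_sq:
  assumes "preconditioner L"
  shows "(norm_L L x)\<^sup>2 = L x x"
  using preconditioner_nonneg[OF assms, of x] by (simp add: norm_L_def inner_L_def)

section \<open>Symmetric Lax--Milgram\<close>

lemma quadratic_functional_attains_min:
  fixes L :: "'a::{real_inner, complete_space} \<Rightarrow> ('a \<Rightarrow>\<^sub>L real)"
    and f :: "'a \<Rightarrow>\<^sub>L real"
  assumes L: "preconditioner L"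
  obtains z where "\<And>x. L z z - 2 * f z \<le> L x x - 2 * f x"
proof -
  define J where "J = (\<lambda>x. L x x - 2 * f x)"
  obtain C where C: "C > 0" "\<And>x. C * (norm x)\<^sup>2 \<le> L x x"
    using preconditioner_coercive[OF L] by metis
  interpret L: bounded_linear L
    by (rule preconditioner_bounded_linear[OF L])
  have J_lower: "- ((norm f)\<^sup>2 / C) \<le> J x" for x
  proof -
    have "0 \<le> (C * norm x - norm f)\<^sup>2 / C"
      using \<open>C > 0\<close> by simp
    also have "\<dots> = C * (norm x)\<^sup>2 - 2 * (norm f * norm x) + (norm f)\<^sup>2 / C"
      using \<open>C > 0\<close> by (simp add: field_simps power2_eq_square)
    finally show ?thesis
      using C(2)[of x] norm_blinfun[of f x] unfolding J_def real_norm_def by linarith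
  qed
  then have bdd: "bdd_below (range J)"
    by (intro bdd_belowI2[where m = "- ((norm f)\<^sup>2 / C)"]) auto
  define m where "m = Inf (range J)"
  have m_le: "m \<le> J x" for x
    unfolding m_def by (rule cInf_lower[OF _ bdd]) simp
  define S where "S n = {x. J x \<le> m + 1 / real (Suc n)}" for n
  have cont: "continuous_on UNIV J"
    unfolding J_def by (intro continuous_intros L.continuous_on)
  have "closed (S n)" for n
    unfolding S_def by (intro closed_Collect_le cont continuous_intros)
  moreover have "S n \<noteq> {}" for n
  proof -
    have "Inf (range J) < m + 1 / real (Suc n)"
      by (simp add: m_def)
    then obtain x where "J x < m + 1 / real (Suc n)"
      using cInf_lessD[of "range J"] by blast
    then show ?thesis
      unfolding S_def by (metis (mono_tags, lifting) empty_iff less_imp_le mem_Collect_eq)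
  qed
  moreover have "S n \<subseteq> S k" if "k \<le> n" for k n
  proof -
    have "1 / real (Suc n) \<le> 1 / real (Suc k)"
      using that by (simp add: frac_le)
    then show ?thesis
      unfolding S_def by force
  qed
  moreover have "\<exists>n. \<forall>x\<in>S n. \<forall>y\<in>S n. dist x y < e" if "e > 0" for e
  proof -
    obtain n where n: "1 / real (Suc n) < C * e\<^sup>2 / 4"
      using C(1) \<open>e > 0\<close> nat_approx_posE[of "C * e\<^sup>2 / 4"]
      by (metis divide_pos_pos mult_pos_pos zero_less_numeral zero_less_power)
    have "dist x y < e" if "x \<in> S n" "y \<in> S n" for x y
    proof -
      \<comment> \<open>The parallelogram law; the linear part of \<open>J\<close> cancels.\<close>
      have "L (x - y) (x - y) = 2 * J x + 2 * J y - 4 * J ((1 / 2) *\<^sub>R (x + y))"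
        unfolding J_def
        by (simp add: L.add L.diff L.scaleR blinfun.bilinear_simps algebra_simps)
      also have "\<dots> \<le> 4 / real (Suc n)"
        using that m_le[of "(1 / 2) *\<^sub>R (x + y)"] unfolding S_def by simp
      also have "\<dots> < C * e\<^sup>2"
        using n by simp
      finally have "C * (norm (x - y))\<^sup>2 < C * e\<^sup>2"
        using C(2)[of "x - y"] by linarith
      then have "norm (x - y) < e"
        using C(1) \<open>e > 0\<close> by (simp add: power_less_imp_less_base)
      then show ?thesis
        by (simp add: dist_norm)
    qed
    then show ?thesis by blast
  qed
  ultimately obtain z where z: "\<And>n. z \<in> S n"
    using decreasing_closed_nest[of S] by metis
  have "J z \<le> m"
  proof (rule field_le_epsilon)
    fix e :: real assume "e > 0"
    then obtain n where "1 / real (Suc n) < e"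
      using nat_approx_posE by blast
    then show "J z \<le> m + e"
      using z[of n] unfolding S_def by simp
  qed
  then have "J z \<le> J x" for x
    using m_le[of x] by linarith
  then show thesis
    by (intro that) (simp add: J_def)
qed

lemma preconditioner_surj:
  fixes L :: "'a::{real_inner, complete_space} \<Rightarrow> ('a \<Rightarrow>\<^sub>L real)"
  assumes L: "preconditioner L"
  shows "surj L"
  unfolding surj_def
proof
  fix f :: "'a \<Rightarrow>\<^sub>L real"
  obtain z where z: "\<And>x. L z z - 2 * f z \<le> L x x - 2 * f x"
    using quadratic_functional_attains_min[OF L] by metis
  obtain C where C: "C > 0" "\<And>x. C * (norm x)\<^sup>2 \<le> L x x"
    using preconditioner_coercive[OF L] by metis
  interpret L: bounded_linear L
    by (rule preconditioner_bounded_linear[OF L])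
  have "f v = L z v" for v
  proof (cases "v = 0")
    case False
    define c where "c = L z v - f v"
    have pos: "L v v > 0"
      using C(1) C(2)[of v] False
      by (smt (verit) mult_pos_pos zero_less_norm_iff zero_less_power)
    \<comment> \<open>\<open>t\<close> minimizes \<open>t\<^sup>2 L v v + 2 t c\<close>, the increment of the functional from \<open>z\<close> to \<open>z + t v\<close>.\<close>
    define t where "t = - (c / L v v)"
    have "0 \<le> t\<^sup>2 * L v v + 2 * t * c"
      using z[of "z + t *\<^sub>R v"] preconditioner_sym[OF L, of v z]
      by (simp add: c_def L.add L.scaleR blinfun.bilinear_simps algebra_simps power2_eq_square)
    also have "\<dots> = - (c\<^sup>2 / L v v)"
      using pos by (simp add: t_def field_simps power2_eq_square)
    finally have "c\<^sup>2 \<le> 0"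
      using pos by (simp add: divide_le_0_iff)
    then show ?thesis
      by (simp add: c_def)
  qed simp
  then have "f = L z"
    by (intro blinfun_eqI)
  then show "\<exists>x. f = L x" ..
qed

section \<open>Strong convexity\<close>

lemma strongly_convex_lower_bound:
  assumes L: "preconditioner L"
    and G: "frechet_deriv_of G G'"
    and conv: "strongly_convex L \<mu> G'"
  shows "G x + G' x (y - x) + \<mu> / 2 * L (y - x) (y - x) \<le> G y"
proof -
  define d where "d = y - x"
  define \<phi> where "\<phi> s = G (x + s *\<^sub>R d) - s * G' x d - \<mu> / 2 * s\<^sup>2 * L d d" for s :: real
  interpret L: bounded_linear L
    by (rule preconditioner_bounded_linear[OF L])
  have deriv: "(\<phi> has_real_derivative (G' (x + s *\<^sub>R d) d - G' x d - \<mu> * s * L d d)) (at s)" for s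
  proof -
    have "((\<lambda>s. G (x + s *\<^sub>R d)) has_derivative (\<lambda>h. G' (x + s *\<^sub>R d) (h *\<^sub>R d))) (at s)"
    proof (rule has_derivative_compose[where f = "\<lambda>s. x + s *\<^sub>R d"])
      show "((\<lambda>s. x + s *\<^sub>R d) has_derivative (\<lambda>h. h *\<^sub>R d)) (at s)"
        by (auto intro!: derivative_eq_intros)
      show "(G has_derivative G' (x + s *\<^sub>R d)) (at (x + s *\<^sub>R d))"
        using G by (simp add: frechet_deriv_of_def)
    qed
    then have "((\<lambda>s. G (x + s *\<^sub>R d)) has_real_derivative G' (x + s *\<^sub>R d) d) (at s)"
      by (simp add: has_field_derivative_def blinfun.scaleR_right mult.commute[of _ "G' (x + s *\<^sub>R d) d"])
    then show ?thesis
      unfolding \<phi>_def by (auto intro!: derivative_eq_intros)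
  qed
  \<comment> \<open>Strong convexity between \<open>x\<close> and \<open>x + s d\<close> makes \<open>\<phi>\<close> nondecreasing.\<close>
  have "\<phi> 0 \<le> \<phi> 1"
  proof (rule DERIV_nonneg_imp_nondecreasing[of 0 1 \<phi>])
    fix s :: real assume "0 \<le> s" "s \<le> 1"
    have "0 \<le> G' (x + s *\<^sub>R d) d - G' x d - \<mu> * s * L d d"
    proof (cases "s = 0")
      case False
      have "\<mu> * L (s *\<^sub>R d) (s *\<^sub>R d) \<le> (G' (x + s *\<^sub>R d) - G' x) (x + s *\<^sub>R d - x)"
        using conv norm_L_sq[OF L, of "x + s *\<^sub>R d - x"] unfolding strongly_convex_def
        by (metis add_diff_cancel_left')
      then have "s * (\<mu> * s * L d d) \<le> s * (G' (x + s *\<^sub>R d) d - G' x d)"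
        by (simp add: L.scaleR blinfun.bilinear_simps algebra_simps)
      then show ?thesis
        using False \<open>0 \<le> s\<close> by simp
    qed simp
    with deriv show "\<exists>D. (\<phi> has_real_derivative D) (at s) \<and> D \<ge> 0"
      by blast
  qed simp
  then show ?thesis
    by (simp add: \<phi>_def d_def)
qed

section \<open>Decay of the energy\<close>

text \<open>
  The pointwise inequality \<open>E' + \<eta> E \<le> 0\<close>, with the derivative of the state replaced by the
  right-hand side of the first-order system in \<open>x\<close> and \<open>v\<close>; here \<open>u\<close> stands for the velocity and
  \<open>g\<close> for the preconditioned gradient.
\<close>

lemma energy_rate_nonpos:
  assumes L: "preconditioner L"
    and G: "frechet_deriv_of G G'"
    and conv: "strongly_convex L \<mu> G'"
    and "\<eta> > 0" "\<eta>\<^sup>2 \<le> \<mu>"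
    and g: "L g = G' x"
    and v: "v = x - xstar + (1 / \<eta>) *\<^sub>R u"
  shows "\<eta> * L v (- u - (1 / \<eta>) *\<^sub>R g) + 1 / \<eta> * G' x u + \<eta> * energy L G xstar \<eta> x v \<le> 0"
proof -
  define w where "w = x - xstar"
  interpret L: bounded_linear L
    by (rule preconditioner_bounded_linear[OF L])
  have u: "u = \<eta> *\<^sub>R (v - w)"
    using \<open>\<eta> > 0\<close> by (simp add: v w_def)
  have Lg: "L v g = G' x v"
    using preconditioner_sym[OF L, of v g] g by simp
  have "\<eta> * L v (- u - (1 / \<eta>) *\<^sub>R g) + 1 / \<eta> * G' x u + \<eta> * energy L G xstar \<eta> x v
      = - (\<eta>\<^sup>2 / 2 * L (v - w) (v - w)) + (\<eta>\<^sup>2 / 2) * L w w + (G x - G xstar - G' x w)"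
    using \<open>\<eta> > 0\<close> preconditioner_sym[OF L, of w v]
    unfolding energy_def norm_L_sq[OF L] u
    by (simp add: Lg L.diff blinfun.bilinear_simps field_simps power2_eq_square)
  also have "\<dots> \<le> - (\<eta>\<^sup>2 / 2 * L (v - w) (v - w)) + ((\<eta>\<^sup>2 - \<mu>) / 2) * L w w"
  proof -
    have "G x + G' x (- w) + \<mu> / 2 * L (- w) (- w) \<le> G xstar"
      using strongly_convex_lower_bound[OF L G conv, of x xstar] by (simp add: w_def)
    then show ?thesis
      by (simp add: L.neg blinfun.bilinear_simps field_simps)
  qed
  also have "\<dots> \<le> 0"
    using preconditioner_nonneg[OF L, of "v - w"] preconditioner_nonneg[OF L, of w] \<open>\<eta>\<^sup>2 \<le> \<mu>\<close>
    by (smt (verit) divide_nonneg_nonneg mult_nonneg_nonneg mult_nonpos_nonneg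
        divide_nonpos_nonneg zero_le_power2)
  finally show ?thesis .
qed

lemma quadratic_form_has_real_derivative:
  assumes L: "preconditioner L"
    and v: "(v has_vector_derivative v') (at t)"
  shows "((\<lambda>t. L (v t) (v t)) has_real_derivative 2 * L (v t) v') (at t)"
proof -
  have "((\<lambda>t. L (v t)) has_vector_derivative L v') (at t)"
    by (rule bounded_linear.has_vector_derivative[OF preconditioner_bounded_linear[OF L] v])
  then have "((\<lambda>t. L (v t) (v t)) has_vector_derivative L (v t) v' + L v' (v t)) (at t)"
    by (rule bounded_bilinear.has_vector_derivative[OF bounded_bilinear_blinfun_apply _ v])
  then show ?thesis
    using preconditioner_sym[OF L, of v' "v t"]
    by (simp add: has_real_derivative_iff_has_vector_derivative)
qed

lemma energy_has_real_derivative: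
  assumes L: "preconditioner L"
    and G: "frechet_deriv_of G G'"
    and x: "(x has_vector_derivative x') (at t)"
    and v: "(v has_vector_derivative v') (at t)"
  shows "((\<lambda>t. energy L G xstar \<eta> (x t) (v t)) has_real_derivative
      \<eta> * L (v t) v' + 1 / \<eta> * G' (x t) x') (at t)"
proof -
  have "((\<lambda>t. G (x t)) has_vector_derivative G' (x t) x') (at t)"
    using G x vector_derivative_diff_chain_within[of x x' t UNIV G "G' (x t)"]
    by (auto simp: frechet_deriv_of_def o_def intro: has_derivative_at_withinI)
  then have "((\<lambda>t. G (x t)) has_real_derivative G' (x t) x') (at t)"
    by (simp add: has_real_derivative_iff_has_vector_derivative)
  then have "((\<lambda>t. G (x t) - G xstar) has_real_derivative G' (x t) x') (at t)"
    by (auto intro!: derivative_eq_intros)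
  from DERIV_add[OF DERIV_cmult[OF quadratic_form_has_real_derivative[OF L v], of "\<eta> / 2"]
      DERIV_cmult[OF this, of "1 / \<eta>"]]
  show ?thesis
    unfolding energy_def norm_L_sq[OF L] by simp
qed

theorem theorem4p4:
  fixes L :: "'a::{real_inner, complete_space} \<Rightarrow> ('a \<Rightarrow>\<^sub>L real)"
    and G :: "'a \<Rightarrow> real" and G' :: "'a \<Rightarrow> ('a \<Rightarrow>\<^sub>L real)"
    and \<mu> \<eta> :: real and xstar x0 :: 'a and X X' V :: "real \<Rightarrow> 'a"
  assumes "separable_space (euclidean :: 'a topology)"
    and "preconditioner L"
    and "frechet_deriv_of G G'"
    and "strongly_convex L \<mu> G'"
    and "locally_lipschitz_smooth L G'"
    and "is_arg_min G (\<lambda>_. True) xstar"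
    and "\<eta> > 0"
    and "ivp_solution L G' \<eta> x0 X X'"
    and "\<And>t. t \<ge> 0 \<Longrightarrow> V t = X t - xstar + (1 / \<eta>) *\<^sub>R X' t"
    and "\<eta>\<^sup>2 \<le> \<mu>"
  shows "antimono_on {0..} (\<lambda>t. exp (\<eta> * t) * energy L G xstar \<eta> (X t) (V t)) \<and>
    (\<forall>t\<ge>0. energy L G xstar \<eta> (X t) (V t)
             = \<eta> / 2 * (norm_L L (V t))\<^sup>2 + 1 / \<eta> * (G (X t) - G xstar) \<and>
           energy L G xstar \<eta> (X t) (V t)
             \<le> exp (- \<eta> * t) *
               (1 / \<eta> * (G x0 - G xstar) + \<eta> / 2 * (norm_L L (x0 - xstar))\<^sup>2))"
proof -
  note L = assms(2) and G = assms(3)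
  interpret L: bounded_linear L
    by (rule preconditioner_bounded_linear[OF L])
  note ivp = assms(8)[unfolded ivp_solution_def]
  from ivp have contX: "continuous_on {0..} X" "continuous_on {0..} X'"
    and dX0: "\<And>t. t \<ge> 0 \<Longrightarrow> (X has_vector_derivative X' t) (at t within {0..})"
    and init: "X 0 = x0" "X' 0 = 0"
    by simp_all
  from ivp obtain X'' where
    "\<forall>t>0. (X' has_vector_derivative X'' t) (at t) \<and>
           X'' t + (2 * \<eta>) *\<^sub>R X' t + inv L (G' (X t)) = 0"
    by meson
  then have dX': "(X' has_vector_derivative X'' t) (at t)"
    and ode: "X'' t + (2 * \<eta>) *\<^sub>R X' t + inv L (G' (X t)) = 0" if "t > 0" for t
    using that by simp_all
  have dX: "(X has_vector_derivative X' t) (at t)" if "t > 0" for t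
  proof -
    have "at t within {0..} = at t"
      by (rule at_within_interior) (use that in \<open>simp add: interior_real_atLeast\<close>)
    then show ?thesis
      using dX0[of t] that by simp
  qed
  \<comment> \<open>\<open>V\<close> is prescribed on the half-line only; \<open>U\<close> is its extension by the same formula.\<close>
  define U where "U t = X t - xstar + (1 / \<eta>) *\<^sub>R X' t" for t
  have VU: "V t = U t" if "t \<ge> 0" for t
    using assms(9)[OF that] by (simp add: U_def)
  define h where "h t = exp (\<eta> * t) * energy L G xstar \<eta> (X t) (U t)" for t
  have dh: "\<exists>D. (h has_real_derivative D) (at t) \<and> D \<le> 0" if "t > 0" for t
  proof -
    define g where "g = inv L (G' (X t))"
    have g: "L g = G' (X t)"
      unfolding g_def by (rule surj_f_inv_f[OF preconditioner_surj[OF L]])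
    define U' where "U' = - X' t - (1 / \<eta>) *\<^sub>R g"
    have "X'' t = - ((2 * \<eta>) *\<^sub>R X' t + g)"
      unfolding g_def eq_neg_iff_add_eq_0 using ode[OF that] by (simp add: add.assoc)
    then have "X' t + (1 / \<eta>) *\<^sub>R X'' t = U'"
      using \<open>\<eta> > 0\<close> by (simp add: U'_def scaleR_diff_right scaleR_2)
    moreover have "(U has_vector_derivative X' t + (1 / \<eta>) *\<^sub>R X'' t) (at t)"
      unfolding U_def[abs_def]
      by (auto intro!: derivative_eq_intros dX dX' that)
    ultimately have dU: "(U has_vector_derivative U') (at t)"
      by simp
    define r where "r = \<eta> * L (U t) U' + 1 / \<eta> * G' (X t) (X' t)"
    have "((\<lambda>t. energy L G xstar \<eta> (X t) (U t)) has_real_derivative r) (at t)"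
      unfolding r_def by (rule energy_has_real_derivative[OF L G dX[OF that] dU])
    then have "(h has_real_derivative
        exp (\<eta> * t) * (r + \<eta> * energy L G xstar \<eta> (X t) (U t))) (at t)"
      unfolding h_def[abs_def] by (auto intro!: derivative_eq_intros simp: algebra_simps)
    moreover have "r + \<eta> * energy L G xstar \<eta> (X t) (U t) \<le> 0"
      unfolding r_def U'_def
      by (rule energy_rate_nonpos[OF L G assms(4,7,10) g]) (simp add: U_def)
    ultimately show ?thesis
      by (meson exp_ge_zero mult_nonneg_nonpos)
  qed
  have "continuous_on UNIV G"
    using G unfolding frechet_deriv_of_def
    by (meson continuous_at_imp_continuous_on has_derivative_continuous)
  then have "continuous_on {0..} (\<lambda>t. G (X t))"
    by (rule continuous_on_compose2) (use contX in auto)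
  moreover have "continuous_on {0..} U"
    unfolding U_def[abs_def] by (intro continuous_intros contX)
  ultimately have conth: "continuous_on {0..} h"
    unfolding h_def[abs_def] energy_def norm_L_sq[OF L]
    by (intro continuous_intros L.continuous_on)
  have decr: "h t \<le> h s" if "0 \<le> s" "s \<le> t" for s t
  proof (cases "s = t")
    case False
    show ?thesis
    proof (rule DERIV_nonpos_imp_decreasing_open[of s t h])
      show "continuous_on {s..t} h"
        using that by (intro continuous_on_subset[OF conth]) auto
    qed (use that dh in auto)
  qed simp
  have h0: "h 0 = 1 / \<eta> * (G x0 - G xstar) + \<eta> / 2 * (norm_L L (x0 - xstar))\<^sup>2"
    by (simp add: h_def U_def energy_def init)
  have "antimono_on {0..} (\<lambda>t. exp (\<eta> * t) * energy L G xstar \<eta> (X t) (V t))"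
    using decr by (intro monotone_onI) (auto simp: VU h_def)
  moreover have "energy L G xstar \<eta> (X t) (V t) \<le> exp (- \<eta> * t) * h 0" if "t \<ge> 0" for t
  proof -
    have "energy L G xstar \<eta> (X t) (V t) = exp (- \<eta> * t) * h t"
      using that by (simp add: VU h_def exp_minus)
    also have "\<dots> \<le> exp (- \<eta> * t) * h 0"
      using decr[of 0 t] that by simp
    finally show ?thesis .
  qed
  ultimately show ?thesis
    unfolding h0 by (auto simp: energy_def)
qed

end
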